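(* Let $0<\tau<\dfrac{1}{6\|p\|_{1,\infty}}$. Let $\{u_N(m\tau),w_N(m\tau)\}_{m\ge 0,\ m\tau\le T}\subset X_{N,P}\times X_{N,P}$ be any solution of the fully implicit scheme with time step $\tau$ and initial datum $w_0$ (as defined in the context). Then for every $t=m\tau\le T$, $m\in\mathbb{N}$, $$\|u_N(t)\|_2\le e^{3T\|p\|_{1,\infty}}\|w_N(0)\|_2\le e^{3T\|p\|_{1,\infty}}\|w_0\|_2,$$ $$\|w_N(t)\|_2\le e^{3T\|p\|_{1,\infty}}\|w_N(0)\|_2\le e^{3T\|p\|_{1,\infty}}\|w_0\|_2 .$$
   Context: $\Omega=(0,L)^2$; $\langle\cdot,\cdot\rangle_2$ and $\|\cdot\|_2$ are the $L^2(\Omega)$ inner product and norm; $\langle u,v\rangle_{H^1}=\langle u,v\rangle_2+\langle\nabla u,\nabla v\rangle_2$. For a function $u$, $\vec V(u)=(-u_y,u_x)$. $p\in W^{1,\infty}(\Omega)$ is given, $\|p\|_{1,\infty}=\max\{\|p\|_{L^\infty},\|p_x\|_{L^\infty},\|p_y\|_{L^\infty}\}$ (with $1/0=+\infty$). $T>0$ is fixed. $w_0=u_0-\Delta u_0\in L^2(\Omega)$, where $u_0\in H^2(\Omega)\cap H^1_P$ is given and $H^1_P$ is the space of $H^1(\Omega)$ functions that are periodic (equal traces on opposite sides of $\Omega$). Finite elements: $\overline\Omega$ is covered by the grid of nodes $\{x_i\}_{i=1}^n\times\{y_j\}_{j=1}^n$, with $0=x_1<\dots<x_n=L$ and similarly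 for $y_j$, and by a conforming structured triangulation based on these nodes. $X_N$ is the space of continuous functions on $\overline\Omega$ that are affine on each triangle, and $X_{N,P}\subset X_N$ is the subspace of functions satisfying periodic boundary conditions (equal values at corresponding points of opposite sides of $\Omega$). Fully implicit scheme: $w_N(0)\in X_{N,P}$ is the $L^2$ projection of $w_0$, $u_N(0)\in X_{N,P}$ satisfies $\langle u_N(0),v\rangle_{H^1}=\langle w_N(0),v\rangle_2$ for all $v\in X_{N,P}$, and for every $t=m\tau$ with $m\ge0$, $t+\tau\le T$, and all $v\in X_{N,P}$, $$\langle w_N(t+\tau)-w_N(t),v\rangle_2=\tau\langle\vec V(u_N(t+\tau))\cdot\nabla v,w_N(t+\tau)\rangle_2+\tau\langle\vec V(p)\cdot\nabla u_N(t+\tau),v\rangle_2,$$ $$\langle u_N(s),v\rangle_{H^1}=\langle w_N(s),v\rangle_2,\qquad s\in\{t,t+\tau\}.$$ *)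

theory Defs
  imports "HOL-Analysis.Analysis" "HOL-Probability.Essential_Supremum"
begin

definition square :: "real \<Rightarrow> (real \<times> real) set"
  where "square L = {0<..<L} \<times> {0<..<L}"

section \<open>Lebesgue spaces\<close>

text \<open>Elements of function spaces are represented by functions on the whole ambient space;
  only their values on the domain matter.\<close>

definition L2 :: "'a::euclidean_space set \<Rightarrow> ('a \<Rightarrow> real) set"
  where "L2 S = {f \<in> borel_measurable (lebesgue_on S). integrable (lebesgue_on S) (\<lambda>z. (f z)\<^sup>2)}"

definition L2_inner :: "'a::euclidean_space set \<Rightarrow> ('a \<Rightarrow> 'b::real_inner) \<Rightarrow> ('a \<Rightarrow> 'b) \<Rightarrow> real"
  where "L2_inner S f g = (LINT z|lebesgue_on S. f z \<bullet> g z)"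

definition L2_norm :: "'a::euclidean_space set \<Rightarrow> ('a \<Rightarrow> 'b::real_inner) \<Rightarrow> real"
  where "L2_norm S f = sqrt (L2_inner S f f)"

definition Linf :: "'a::euclidean_space set \<Rightarrow> ('a \<Rightarrow> real) set"
  where "Linf S = {f \<in> borel_measurable (lebesgue_on S).
    esssup (lebesgue_on S) (\<lambda>z. ereal \<bar>f z\<bar>) < \<infinity>}"

definition Linf_norm :: "'a::euclidean_space set \<Rightarrow> ('a \<Rightarrow> real) \<Rightarrow> real"
  where "Linf_norm S f = real_of_ereal (esssup (lebesgue_on S) (\<lambda>z. ereal \<bar>f z\<bar>))"

section \<open>Weak derivatives and Sobolev spaces in the plane\<close>

text \<open>\<open>D i j\<close> is the mixed partial derivative of order \<open>i\<close> in \<open>x\<close> and \<open>j\<close> in \<open>y\<close>.\<close>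

definition smooth_plane :: "(real \<times> real \<Rightarrow> real) \<Rightarrow> bool"
  where "smooth_plane f \<longleftrightarrow> (\<exists>D :: nat \<Rightarrow> nat \<Rightarrow> real \<times> real \<Rightarrow> real. D 0 0 = f \<and>
    (\<forall>i j z. (D i j has_derivative
      (\<lambda>h. fst h * D (Suc i) j z + snd h * D i (Suc j) z)) (at z)))"

definition test_function :: "(real \<times> real) set \<Rightarrow> (real \<times> real \<Rightarrow> real) \<Rightarrow> bool"
  where "test_function S \<phi> \<longleftrightarrow> smooth_plane \<phi> \<and>
    compact (closure {z. \<phi> z \<noteq> 0}) \<and> closure {z. \<phi> z \<noteq> 0} \<subseteq> S"

text \<open>Classical gradient. It is used for smooth functions and for continuous piecewise affine
  functions. The latter are differentiable off the null set of triangle edges, and there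
  the classical gradient is the constant elementwise gradient; the unspecified values on
  the edges do not affect any integral with respect to the (complete) Lebesgue measure.\<close>

definition grad :: "(real \<times> real \<Rightarrow> real) \<Rightarrow> real \<times> real \<Rightarrow> real \<times> real"
  where "grad f z = (frechet_derivative f (at z) (1, 0), frechet_derivative f (at z) (0, 1))"

definition locally_integrable :: "(real \<times> real) set \<Rightarrow> (real \<times> real \<Rightarrow> real) \<Rightarrow> bool"
  where "locally_integrable S f \<longleftrightarrow>
    (\<forall>K. compact K \<longrightarrow> K \<subseteq> S \<longrightarrow> f absolutely_integrable_on K)"

definition has_weak_deriv ::
    "real \<times> real \<Rightarrow> (real \<times> real) set \<Rightarrow> (real \<times> real \<Rightarrow> real) \<Rightarrow> (real \<times> real \<Rightarrow> real) \<Rightarrow> bool"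
  where "has_weak_deriv e S f g \<longleftrightarrow> locally_integrable S f \<and> locally_integrable S g \<and>
    (\<forall>\<phi>. test_function S \<phi> \<longrightarrow>
      L2_inner S f (\<lambda>z. grad \<phi> z \<bullet> e) = - L2_inner S g \<phi>)"

text \<open>Weak derivatives are unique up to null sets, so the choice below is immaterial.\<close>

definition weak_deriv ::
    "real \<times> real \<Rightarrow> (real \<times> real) set \<Rightarrow> (real \<times> real \<Rightarrow> real) \<Rightarrow> real \<times> real \<Rightarrow> real"
  where "weak_deriv e S f = (SOME g. has_weak_deriv e S f g)"

definition weakly_differentiable :: "(real \<times> real) set \<Rightarrow> (real \<times> real \<Rightarrow> real) \<Rightarrow> bool"
  where "weakly_differentiable S f \<longleftrightarrow>
    (\<exists>g. has_weak_deriv (1, 0) S f g) \<and> (\<exists>g. has_weak_deriv (0, 1) S f g)"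

definition weak_grad :: "(real \<times> real) set \<Rightarrow> (real \<times> real \<Rightarrow> real) \<Rightarrow> real \<times> real \<Rightarrow> real \<times> real"
  where "weak_grad S f z = (weak_deriv (1, 0) S f z, weak_deriv (0, 1) S f z)"

definition weak_laplacian :: "(real \<times> real) set \<Rightarrow> (real \<times> real \<Rightarrow> real) \<Rightarrow> real \<times> real \<Rightarrow> real"
  where "weak_laplacian S f z =
    weak_deriv (1, 0) S (weak_deriv (1, 0) S f) z + weak_deriv (0, 1) S (weak_deriv (0, 1) S f) z"

definition H1 :: "(real \<times> real) set \<Rightarrow> (real \<times> real \<Rightarrow> real) set"
  where "H1 S = {u \<in> L2 S. weakly_differentiable S u \<and>
    weak_deriv (1, 0) S u \<in> L2 S \<and> weak_deriv (0, 1) S u \<in> L2 S}"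

definition H2 :: "(real \<times> real) set \<Rightarrow> (real \<times> real \<Rightarrow> real) set"
  where "H2 S = {u \<in> H1 S. weak_deriv (1, 0) S u \<in> H1 S \<and> weak_deriv (0, 1) S u \<in> H1 S}"

definition W1inf :: "(real \<times> real) set \<Rightarrow> (real \<times> real \<Rightarrow> real) set"
  where "W1inf S = {p \<in> Linf S. weakly_differentiable S p \<and>
    weak_deriv (1, 0) S p \<in> Linf S \<and> weak_deriv (0, 1) S p \<in> Linf S}"

definition W1inf_norm :: "(real \<times> real) set \<Rightarrow> (real \<times> real \<Rightarrow> real) \<Rightarrow> real"
  where "W1inf_norm S p =
    Max {Linf_norm S p, Linf_norm S (weak_deriv (1, 0) S p), Linf_norm S (weak_deriv (0, 1) S p)}"

text \<open>The trace on the side parametrised by \<open>\<gamma>\<close> over \<open>(0, L)\<close>: the trace operator is the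
  continuous extension of restriction to the side from functions smooth up to the boundary
  (which are dense in \<open>H1\<close>) to all of \<open>H1\<close>.\<close>

definition has_side_trace ::
    "real \<Rightarrow> (real \<Rightarrow> real \<times> real) \<Rightarrow> (real \<times> real \<Rightarrow> real) \<Rightarrow> (real \<Rightarrow> real) \<Rightarrow> bool"
  where "has_side_trace L \<gamma> u g \<longleftrightarrow> g \<in> L2 {0<..<L} \<and>
    (\<exists>\<phi> :: nat \<Rightarrow> real \<times> real \<Rightarrow> real. (\<forall>k. smooth_plane (\<phi> k)) \<and>
      (\<lambda>k. L2_norm (square L) (\<lambda>z. \<phi> k z - u z)) \<longlonglongrightarrow> 0 \<and>
      (\<lambda>k. L2_norm (square L) (\<lambda>z. grad (\<phi> k) z - weak_grad (square L) u z)) \<longlonglongrightarrow> 0 \<and>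
      (\<lambda>k. L2_norm {0<..<L} (\<lambda>s. \<phi> k (\<gamma> s) - g s)) \<longlonglongrightarrow> 0)"

definition H1_periodic :: "real \<Rightarrow> (real \<times> real \<Rightarrow> real) set"
  where "H1_periodic L = {u \<in> H1 (square L).
    (\<exists>g. has_side_trace L (\<lambda>s. (0, s)) u g \<and> has_side_trace L (\<lambda>s. (L, s)) u g) \<and>
    (\<exists>g. has_side_trace L (\<lambda>s. (s, 0)) u g \<and> has_side_trace L (\<lambda>s. (s, L)) u g)}"

section \<open>Finite elements\<close>

definition grid :: "real \<Rightarrow> nat \<Rightarrow> (nat \<Rightarrow> real) \<Rightarrow> bool"
  where "grid L n x \<longleftrightarrow> 2 \<le> n \<and> x 1 = 0 \<and> x n = L \<and> strict_mono_on {1..n} x"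

text \<open>The two triangles into which \<open>[a, b] \<times> [c, d]\<close> is cut by one of its diagonals.\<close>

definition split_cell :: "real \<Rightarrow> real \<Rightarrow> real \<Rightarrow> real \<Rightarrow> bool \<Rightarrow> (real \<times> real) set set"
  where "split_cell a b c d rising =
    (if rising
     then {convex hull {(a, c), (b, c), (b, d)}, convex hull {(a, c), (a, d), (b, d)}}
     else {convex hull {(a, c), (b, c), (a, d)}, convex hull {(b, c), (a, d), (b, d)}})"

text \<open>Each grid cell is cut by one of its diagonals, chosen cell by cell. All such
  triangulations are conforming: neighbouring cells share full edges.\<close>

definition structured_triangulation ::
    "nat \<Rightarrow> (nat \<Rightarrow> real) \<Rightarrow> (nat \<Rightarrow> real) \<Rightarrow> (real \<times> real) set set \<Rightarrow> bool"
  where "structured_triangulation n x y \<T> \<longleftrightarrow> (\<exists>\<delta> :: nat \<Rightarrow> nat \<Rightarrow> bool.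
    \<T> = (\<Union>i\<in>{1..<n}. \<Union>j\<in>{1..<n}. split_cell (x i) (x (Suc i)) (y j) (y (Suc j)) (\<delta> i j)))"

definition X_N :: "real \<Rightarrow> (real \<times> real) set set \<Rightarrow> (real \<times> real \<Rightarrow> real) set"
  where "X_N L \<T> = {f. continuous_on (closure (square L)) f \<and>
    (\<forall>K\<in>\<T>. \<exists>c a. \<forall>z\<in>K. f z = c + a \<bullet> z)}"

definition X_NP :: "real \<Rightarrow> (real \<times> real) set set \<Rightarrow> (real \<times> real \<Rightarrow> real) set"
  where "X_NP L \<T> = {f \<in> X_N L \<T>. \<forall>s\<in>{0..L}. f (0, s) = f (L, s) \<and> f (s, 0) = f (s, L)}"

definition H1_inner :: "(real \<times> real) set \<Rightarrow> (real \<times> real \<Rightarrow> real) \<Rightarrow> (real \<times> real \<Rightarrow> real) \<Rightarrow> real"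
  where "H1_inner S u v = L2_inner S u v + L2_inner S (grad u) (grad v)"

text \<open>\<open>V(u) = (-u_y, u_x)\<close>, as a function of the gradient field of \<open>u\<close>.\<close>

definition vec_V :: "(real \<times> real \<Rightarrow> real \<times> real) \<Rightarrow> real \<times> real \<Rightarrow> real \<times> real"
  where "vec_V du z = (- snd (du z), fst (du z))"

definition is_L2_projection ::
    "(real \<times> real) set \<Rightarrow> (real \<times> real \<Rightarrow> real) set \<Rightarrow> (real \<times> real \<Rightarrow> real) \<Rightarrow> (real \<times> real \<Rightarrow> real) \<Rightarrow> bool"
  where "is_L2_projection S X f Pf \<longleftrightarrow> Pf \<in> X \<and> (\<forall>v\<in>X. L2_inner S (\<lambda>z. f z - Pf z) v = 0)"

text \<open>\<open>uN m\<close> and \<open>wN m\<close> stand for the discrete solution at time \<open>m * \<tau>\<close>; they are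
  unconstrained when that time exceeds \<open>T\<close>.\<close>

definition fully_implicit_solution ::
    "real \<Rightarrow> (real \<times> real) set set \<Rightarrow> (real \<times> real \<Rightarrow> real) \<Rightarrow> real \<Rightarrow> real \<Rightarrow> (real \<times> real \<Rightarrow> real) \<Rightarrow>
     (nat \<Rightarrow> real \<times> real \<Rightarrow> real) \<Rightarrow> (nat \<Rightarrow> real \<times> real \<Rightarrow> real) \<Rightarrow> bool"
  where "fully_implicit_solution L \<T> p T \<tau> w0 uN wN \<longleftrightarrow>
    (\<forall>m. real m * \<tau> \<le> T \<longrightarrow> uN m \<in> X_NP L \<T> \<and> wN m \<in> X_NP L \<T>) \<and>
    is_L2_projection (square L) (X_NP L \<T>) w0 (wN 0) \<and>
    (\<forall>v\<in>X_NP L \<T>. H1_inner (square L) (uN 0) v = L2_inner (square L) (wN 0) v) \<and>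
    (\<forall>m. real m * \<tau> + \<tau> \<le> T \<longrightarrow> (\<forall>v\<in>X_NP L \<T>.
      L2_inner (square L) (\<lambda>z. wN (Suc m) z - wN m z) v =
        \<tau> * L2_inner (square L) (\<lambda>z. vec_V (grad (uN (Suc m))) z \<bullet> grad v z) (wN (Suc m)) +
        \<tau> * L2_inner (square L)
              (\<lambda>z. vec_V (weak_grad (square L) p) z \<bullet> grad (uN (Suc m)) z) v \<and>
      (\<forall>k\<in>{m, Suc m}. H1_inner (square L) (uN k) v = L2_inner (square L) (wN k) v)))"

end

theory Submission
  imports Defs
begin

text \<open>Testing the scheme with \<open>v = w\<^sub>N(t + \<tau>)\<close> makes the transport term vanish: on a triangle where \<open>u\<close> and \<open>w\<close>
  are affine, \<open>(V(u) \<bullet> \<nabla>w) w dx dy = w du \<and> dw = - d(w\<^sup>2 / 2 du)\<close>, so its integral is a sum of fluxes through the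
  three edges. These depend only on the values of \<open>u\<close> and \<open>w\<close> at the end points of the edge; hence they
  cancel across interior edges, and by periodicity between opposite sides of the square. The elliptic
  equation tested with \<open>v = u\<^sub>N\<close> gives \<open>\<parallel>u\<parallel> \<le> \<parallel>w\<parallel>\<close> and \<open>\<parallel>\<nabla>u\<parallel> \<le> \<parallel>w\<parallel> / 2\<close>, so by Young's inequality
  the remaining term is at most \<open>3/4 \<tau> \<parallel>p\<parallel> \<parallel>w\<parallel>\<^sup>2\<close>. Each step therefore multiplies \<open>\<parallel>w\<parallel>\<^sup>2\<close> by at most
  \<open>1 / (1 - 3/2 \<tau> \<parallel>p\<parallel>) \<le> exp (6 \<tau> \<parallel>p\<parallel>)\<close>.\<close>

section \<open>Essentially bounded and square integrable functions\<close>

text \<open>Neither infinite value of the essential supremum survives: +\<infinity> is excluded by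
  membership in \<open>Linf\<close>, -\<infinity> because it cannot bound an absolute value. So
  \<open>real_of_ereal\<close> loses nothing.\<close>

lemma AE_le_Linf_norm:
  assumes "f \<in> Linf S"
  shows "AE z in lebesgue_on S. \<bar>f z\<bar> \<le> Linf_norm S f"
  using esssup_AE[of "\<lambda>z. ereal \<bar>f z\<bar>" "lebesgue_on S"]
proof eventually_elim
  case (elim z)
  with assms show ?case
    by (cases "esssup (lebesgue_on S) (\<lambda>z. ereal \<bar>f z\<bar>)") (auto simp: Linf_def Linf_norm_def)
qed

lemma Linf_norm_nonneg:
  assumes "f \<in> Linf S"
  shows "0 \<le> Linf_norm S f"
proof (cases "ae_filter (lebesgue_on S) = bot")
  \<comment> \<open>On a null set the essential supremum is -\<infinity>, which
    \<open>real_of_ereal\<close> sends to 0.\<close>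
  case True
  have "(\<lambda>z. ereal \<bar>f z\<bar>) \<in> borel_measurable (lebesgue_on S)"
    using assms by (auto simp: Linf_def)
  from esssup_zero_space[OF _ this] True show ?thesis
    by (simp add: Linf_norm_def ae_filter_eq_bot_iff)
next
  case False
  then show ?thesis
    using eventually_happens'[OF False AE_le_Linf_norm[OF assms]] by (meson abs_ge_zero order_trans)
qed

text \<open>Lets membership be shown by any almost everywhere bound, without computing an essential
  supremum.\<close>

lemma Linf_iff:
  "f \<in> Linf S \<longleftrightarrow> f \<in> borel_measurable (lebesgue_on S) \<and> (\<exists>C. AE z in lebesgue_on S. \<bar>f z\<bar> \<le> C)"
proof
  assume "f \<in> Linf S"
  then show "f \<in> borel_measurable (lebesgue_on S) \<and> (\<exists>C. AE z in lebesgue_on S. \<bar>f z\<bar> \<le> C)"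
    using AE_le_Linf_norm by (auto simp: Linf_def)
next
  assume "f \<in> borel_measurable (lebesgue_on S) \<and> (\<exists>C. AE z in lebesgue_on S. \<bar>f z\<bar> \<le> C)"
  then obtain C where "f \<in> borel_measurable (lebesgue_on S)" "AE z in lebesgue_on S. \<bar>f z\<bar> \<le> C"
    by blast
  then have "esssup (lebesgue_on S) (\<lambda>z. ereal \<bar>f z\<bar>) \<le> ereal C"
    by (intro esssup_I) auto
  also have "\<dots> < \<infinity>" by simp
  finally show "f \<in> Linf S"
    using \<open>f \<in> borel_measurable _\<close> by (simp add: Linf_def)
qed

lemma Linf_mult:
  assumes "f \<in> Linf S" "g \<in> Linf S"
  shows "(\<lambda>z. f z * g z) \<in> Linf S"
proof -
  have "AE z in lebesgue_on S. \<bar>f z * g z\<bar> \<le> Linf_norm S f * Linf_norm S g"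
    using AE_le_Linf_norm[OF assms(1)] AE_le_Linf_norm[OF assms(2)]
    by eventually_elim (simp add: abs_mult mult_mono)
  moreover have "(\<lambda>z. f z * g z) \<in> borel_measurable (lebesgue_on S)"
    using assms by (auto simp: Linf_def)
  ultimately show ?thesis
    unfolding Linf_iff by blast
qed

lemma Linf_add:
  assumes "f \<in> Linf S" "g \<in> Linf S"
  shows "(\<lambda>z. f z + g z) \<in> Linf S"
proof -
  have "AE z in lebesgue_on S. \<bar>f z + g z\<bar> \<le> Linf_norm S f + Linf_norm S g"
    using AE_le_Linf_norm[OF assms(1)] AE_le_Linf_norm[OF assms(2)]
    by eventually_elim (metis abs_triangle_ineq add_mono order_trans)
  moreover have "(\<lambda>z. f z + g z) \<in> borel_measurable (lebesgue_on S)"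
    using assms by (auto simp: Linf_def)
  ultimately show ?thesis
    unfolding Linf_iff by blast
qed

lemma Linf_uminus: "f \<in> Linf S \<Longrightarrow> (\<lambda>z. - f z) \<in> Linf S"
  by (simp add: Linf_iff)

lemma Linf_integrable:
  assumes "f \<in> Linf S" "S \<in> lmeasurable"
  shows "integrable (lebesgue_on S) f"
  using AE_le_Linf_norm[OF assms(1)] assms
  by (intro finite_measure.integrable_const_bound[OF finite_measure_lebesgue_on])
     (auto simp: Linf_def)

lemma Linf_subset_L2: "S \<in> lmeasurable \<Longrightarrow> f \<in> Linf S \<Longrightarrow> f \<in> L2 S"
  using Linf_integrable[OF Linf_mult[of f S f]] by (auto simp: L2_def Linf_iff power2_eq_square)

lemma L2_mult_integrable:
  assumes "f \<in> L2 S" "g \<in> L2 S"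
  shows "integrable (lebesgue_on S) (\<lambda>z. f z * g z)"
proof (rule Bochner_Integration.integrable_bound)
  show "integrable (lebesgue_on S) (\<lambda>z. (f z)\<^sup>2 + (g z)\<^sup>2)"
    using assms by (auto simp: L2_def)
  have "\<bar>f z * g z\<bar> \<le> (f z)\<^sup>2 + (g z)\<^sup>2" for z
  proof -
    have "2 * \<bar>f z\<bar> * \<bar>g z\<bar> \<le> (f z)\<^sup>2 + (g z)\<^sup>2"
      using sum_squares_bound[of "\<bar>f z\<bar>" "\<bar>g z\<bar>"] by simp
    moreover have "0 \<le> \<bar>f z\<bar> * \<bar>g z\<bar>" by simp
    ultimately show ?thesis unfolding abs_mult by linarith
  qed
  then show "AE z in lebesgue_on S. norm (f z * g z) \<le> norm ((f z)\<^sup>2 + (g z)\<^sup>2)"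
    by simp
qed (use assms in \<open>auto simp: L2_def\<close>)

lemma L2_inner_diff_left:
  fixes f g h :: "'a::euclidean_space \<Rightarrow> real"
  assumes "f \<in> L2 S" "g \<in> L2 S" "h \<in> L2 S"
  shows "L2_inner S (\<lambda>z. f z - g z) h = L2_inner S f h - L2_inner S g h"
  using L2_mult_integrable[OF assms(1,3)] L2_mult_integrable[OF assms(2,3)]
  by (simp add: L2_inner_def left_diff_distrib)

lemma L2_inner_self_nonneg: "0 \<le> L2_inner S f f"
  by (simp add: L2_inner_def)

section \<open>Energy inequalities for the projection, the elliptic equation and the convection
  term\<close>

text \<open>Integrates a completed square. Being stated for squared norms with a free weight, it
  takes the place of Cauchy-Schwarz below, with \<open>c = 1\<close> and
  \<open>c = 1/2\<close>.\<close>

lemma L2_inner_young: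
  fixes f g :: "'a::euclidean_space \<Rightarrow> real"
  assumes f: "f \<in> L2 S" and g: "g \<in> L2 S" and "0 < c"
  shows "2 * L2_inner S f g \<le> c * L2_inner S f f + L2_inner S g g / c"
proof -
  have "2 * (f z * g z) \<le> c * (f z * f z) + g z * g z / c" for z
  proof -
    have "0 \<le> (c * f z - g z)\<^sup>2" by simp
    then have "2 * (f z * g z) * c \<le> (c * (f z * f z) + g z * g z / c) * c"
      using \<open>0 < c\<close> by (simp add: power2_eq_square algebra_simps)
    then show ?thesis
      using \<open>0 < c\<close> by simp
  qed
  then have "(LINT z|lebesgue_on S. 2 * (f z * g z)) \<le> (LINT z|lebesgue_on S. c * (f z * f z) + g z * g z / c)"
    using L2_mult_integrable[OF f f] L2_mult_integrable[OF f g] L2_mult_integrable[OF g g]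
    by (intro integral_mono) auto
  then show ?thesis
    using L2_mult_integrable[OF f f] L2_mult_integrable[OF f g] L2_mult_integrable[OF g g]
    by (simp add: L2_inner_def)
qed

lemma L2_norm_le_iff: "L2_norm S f \<le> L2_norm S g \<longleftrightarrow> L2_inner S f f \<le> L2_inner S g g"
  by (simp add: L2_norm_def)

text \<open>The error is orthogonal to \<open>Pf\<close> itself, so the inner product of
  \<open>f\<close> and \<open>Pf\<close> is the squared norm of \<open>Pf\<close>; Young's
  inequality with weight 1 finishes.\<close>

lemma L2_projection_norm_le:
  assumes "is_L2_projection S X f Pf" "f \<in> L2 S" "X \<subseteq> L2 S"
  shows "L2_norm S Pf \<le> L2_norm S f"
proof -
  have Pf: "Pf \<in> L2 S" "L2_inner S (\<lambda>z. f z - Pf z) Pf = 0"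
    using assms by (auto simp: is_L2_projection_def)
  then have "L2_inner S f Pf = L2_inner S Pf Pf"
    by (simp add: L2_inner_diff_left assms(2))
  with L2_inner_young[OF assms(2) Pf(1), of 1] show ?thesis
    by (simp add: L2_norm_le_iff)
qed

text \<open>By Young, the inner product of \<open>w\<close> and \<open>u\<close> is at most half the
  sum of the two squared norms, which gives the first bound. With weight 1/2 it is at most a quarter
  of the squared norm of \<open>w\<close> plus that of \<open>u\<close>; the latter cancels and
  leaves the gradient.\<close>

lemma H1_inner_elliptic_bounds:
  assumes "u \<in> L2 S" "w \<in> L2 S" "H1_inner S u u = L2_inner S w u"
  shows "L2_inner S u u \<le> L2_inner S w w"
    and "4 * L2_inner S (grad u) (grad u) \<le> L2_inner S w w"
  using L2_inner_young[OF assms(2,1), of 1] L2_inner_young[OF assms(2,1), of "1/2"] assms(3)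
    L2_inner_self_nonneg[of S "grad u"] by (simp_all add: H1_inner_def)

text \<open>The integrand is a sum of two products, each a derivative of \<open>p\<close> times a
  derivative of \<open>u\<close> times \<open>w\<close>. Young's inequality is applied pointwise to
  each, so \<open>w\<^sup>2 / 4\<close> occurs twice.\<close>

lemma L2_inner_convection_le:
  assumes S: "S \<in> lmeasurable" and p: "p \<in> W1inf S" and w: "w \<in> Linf S"
    and u: "\<And>e. (\<lambda>z. grad u z \<bullet> e) \<in> Linf S"
  shows "L2_inner S (\<lambda>z. vec_V (weak_grad S p) z \<bullet> grad u z) w
    \<le> W1inf_norm S p * (L2_inner S (grad u) (grad u) + L2_inner S w w / 2)"
proof -
  let ?P = "W1inf_norm S p" and ?M = "lebesgue_on S"
  let ?px = "weak_deriv (1, 0) S p" and ?py = "weak_deriv (0, 1) S p"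
  have px: "?px \<in> Linf S" and py: "?py \<in> Linf S" and "p \<in> Linf S"
    using p by (auto simp: W1inf_def)
  have ux: "(\<lambda>z. fst (grad u z)) \<in> Linf S" and uy: "(\<lambda>z. snd (grad u z)) \<in> Linf S"
    using u[of "(1, 0)"] u[of "(0, 1)"] by (simp_all add: inner_prod_def)
  have int: "integrable ?M (\<lambda>z. fst (grad u z) * fst (grad u z))"
      "integrable ?M (\<lambda>z. snd (grad u z) * snd (grad u z))" "integrable ?M (\<lambda>z. w z * w z)"
    using ux uy w S by (auto intro: Linf_integrable Linf_mult)
  have "(LINT z|?M. (- ?py z * fst (grad u z) + ?px z * snd (grad u z)) * w z)
      \<le> (LINT z|?M. ?P * (fst (grad u z) * fst (grad u z) + snd (grad u z) * snd (grad u z) + w z * w z / 2))"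
  proof (rule integral_mono_AE)
    show "integrable ?M (\<lambda>z. (- ?py z * fst (grad u z) + ?px z * snd (grad u z)) * w z)"
      using px py ux uy w S by (intro Linf_integrable Linf_mult Linf_add Linf_uminus)
    show "integrable ?M (\<lambda>z. ?P * (fst (grad u z) * fst (grad u z) + snd (grad u z) * snd (grad u z) + w z * w z / 2))"
      using int by auto
    show "AE z in ?M. (- ?py z * fst (grad u z) + ?px z * snd (grad u z)) * w z
        \<le> ?P * (fst (grad u z) * fst (grad u z) + snd (grad u z) * snd (grad u z) + w z * w z / 2)"
      using AE_le_Linf_norm[OF px] AE_le_Linf_norm[OF py]
    proof eventually_elim
      case (elim z)
      let ?w = "w z"
      have P: "\<bar>?px z\<bar> \<le> ?P" "\<bar>?py z\<bar> \<le> ?P"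
        using elim by (auto simp: W1inf_norm_def intro: order_trans)
      \<comment> \<open>Used with \<open>a\<close> a signed derivative of \<open>p\<close> and
        \<open>b\<close> a derivative of \<open>u\<close>.\<close>
      have young: "a * b * ?w \<le> ?P * (b * b + ?w * ?w / 4)" if "\<bar>a\<bar> \<le> ?P" for a b
      proof -
        have "0 \<le> (\<bar>b\<bar> - \<bar>?w\<bar> / 2)\<^sup>2" by simp
        then have "\<bar>b\<bar> * \<bar>?w\<bar> \<le> b * b + ?w * ?w / 4"
          by (simp add: power2_eq_square algebra_simps)
        then have "\<bar>a\<bar> * (\<bar>b\<bar> * \<bar>?w\<bar>) \<le> ?P * (b * b + ?w * ?w / 4)"
          using that by (intro mult_mono) auto
        moreover have "a * b * ?w \<le> \<bar>a\<bar> * (\<bar>b\<bar> * \<bar>?w\<bar>)"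
          by (metis abs_ge_self abs_mult mult.assoc)
        ultimately show ?thesis by linarith
      qed
      show ?case
        using young[of "- ?py z" "fst (grad u z)"] young[of "?px z" "snd (grad u z)"] P
        by (simp add: algebra_simps)
    qed
  qed
  then show ?thesis
    using int by (simp add: L2_inner_def vec_V_def weak_grad_def inner_prod_def)
qed

lemma W1inf_norm_nonneg: "p \<in> W1inf S \<Longrightarrow> 0 \<le> W1inf_norm S p"
  using Linf_norm_nonneg[of p S] by (auto simp: W1inf_norm_def W1inf_def le_max_iff_disj)

text \<open>Here \<open>t\<close> is \<tau> times the norm of \<open>p\<close>, and
  \<open>A\<close>, \<open>B\<close> are the squared norms of \<open>w\<close> after and before a
  step. The product (1 + 6t)(1 - 3t/2) = 1 + 9t/2 - 9t^2 is at least 1 on the given range of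
  \<open>t\<close>, and 1 + 6t is at most exp(6t). The rate 6 for squares becomes 3 for
  norms.\<close>

lemma implicit_step_growth:
  fixes A B t :: real
  assumes "0 \<le> t" "t \<le> 1/6" "0 \<le> A" "A * (1 - 3 / 2 * t) \<le> B"
  shows "A \<le> exp (6 * t) * B"
proof -
  have "t * t \<le> 1/6 * t"
    using assms by (intro mult_right_mono)
  then have "1 \<le> (1 + 6 * t) * (1 - 3 / 2 * t)"
    using assms(1) by (simp add: algebra_simps)
  also have "\<dots> \<le> exp (6 * t) * (1 - 3 / 2 * t)"
    using assms by (intro mult_right_mono exp_ge_add_one_self) auto
  finally have "A \<le> A * (exp (6 * t) * (1 - 3 / 2 * t))"
    using mult_left_mono[OF _ assms(3)] by fastforce
  also have "\<dots> = exp (6 * t) * (A * (1 - 3 / 2 * t))" by simp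
  also have "\<dots> \<le> exp (6 * t) * B"
    using assms by (intro mult_left_mono) auto
  finally show ?thesis .
qed

section \<open>The transport term on a triangle\<close>

text \<open>The fibre of the standard triangle over \<open>s\<close> is the interval from 0 to
  \<open>1 - s\<close>, empty unless \<open>s\<close> lies in the unit interval.\<close>

lemma integral_triangle_fiber:
  fixes a b c s :: real
  shows "(LINT t|lborel. indicator {z. 0 \<le> fst z \<and> 0 \<le> snd z \<and> fst z + snd z \<le> 1} (s, t) *
            (a + b * s + c * t)) =
         indicator {0..1} s * ((a + b * s) * (1 - s) + c / 2 * (1 - s)\<^sup>2)"
proof (cases "0 \<le> s \<and> s \<le> 1")
  case True
  have "(LINT t|lborel. (a + b * s + c * t) * indicator {0..1 - s} t) =
      ((a + b * s) * (1 - s) + c / 2 * (1 - s)\<^sup>2) - ((a + b * s) * 0 + c / 2 * 0\<^sup>2)"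
    using True by (intro integral_FTC_Icc_real) (auto intro!: derivative_eq_intros continuous_intros)
  moreover have "(\<lambda>t. indicator {z. 0 \<le> fst z \<and> 0 \<le> snd z \<and> fst z + snd z \<le> 1} (s, t) * (a + b * s + c * t))
      = (\<lambda>t. (a + b * s + c * t) * indicator {0..1 - s} t)"
    using True by (auto simp: indicator_def fun_eq_iff)
  ultimately show ?thesis
    using True by simp
next
  case False
  then have "(\<lambda>t. indicator {z. 0 \<le> fst z \<and> 0 \<le> snd z \<and> fst z + snd z \<le> 1} (s, t) * (a + b * s + c * t))
      = (\<lambda>t. 0)"
    by (auto simp: indicator_def fun_eq_iff)
  with False show ?thesis by (simp add: indicator_def)
qed

lemma integral_standard_triangle:
  fixes a b c :: real
  shows "(LINT s|lborel. LINT t|lborel. indicator {z. 0 \<le> fst z \<and> 0 \<le> snd z \<and> fst z + snd z \<le> 1} (s, t) *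
            (a + b * s + c * t)) = a / 2 + b / 6 + c / 6"
proof -
  let ?F = "\<lambda>s. a * (s - s\<^sup>2 / 2) + b * (s\<^sup>2 / 2 - s ^ 3 / 3) - c / 6 * (1 - s) ^ 3"
  have "(LINT s|lborel. ((a + b * s) * (1 - s) + c / 2 * (1 - s)\<^sup>2) * indicator {0..1} s) = ?F 1 - ?F 0"
    by (intro integral_FTC_Icc_real)
      (auto intro!: derivative_eq_intros continuous_intros simp: field_simps power2_eq_square)
  then show ?thesis
    unfolding integral_triangle_fiber by (simp add: mult.commute field_simps)
qed

text \<open>The legs \<open>h\<close> and \<open>k\<close> may be negative, so one definition covers
  all four positions of an axis-parallel right angle at \<open>(p, q)\<close>.\<close>

definition right_triangle :: "real \<Rightarrow> real \<Rightarrow> real \<Rightarrow> real \<Rightarrow> (real \<times> real) set"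
  where "right_triangle p q h k = convex hull {(p, q), (p + h, q), (p, q + k)}"

text \<open>The numbers \<open>s\<close> and \<open>t\<close> are the barycentric weights of the two
  acute vertices, unique because the legs do not vanish.\<close>

lemma right_triangle_iff:
  assumes "h \<noteq> 0" "k \<noteq> 0"
  shows "(p + h * s, q + k * t) \<in> right_triangle p q h k \<longleftrightarrow> 0 \<le> s \<and> 0 \<le> t \<and> s + t \<le> 1"
  using assms by (auto simp: right_triangle_def convex_hull_3_alt)

lemma compact_right_triangle: "compact (right_triangle p q h k)"
  and convex_right_triangle: "convex (right_triangle p q h k)"
  by (simp_all add: right_triangle_def finite_imp_compact_convex_hull)

lemma negligible_frontier_right_triangle: "negligible (frontier (right_triangle p q h k))"
  by (simp add: negligible_convex_frontier convex_right_triangle)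

text \<open>The vertex rule, area times mean of the vertex values, is exact for affine functions. It
  is reduced by Fubini and rescaling of each variable to the standard triangle.\<close>

lemma has_integral_affine_right_triangle:
  fixes f :: "real \<times> real \<Rightarrow> real"
  assumes "h \<noteq> 0" "k \<noteq> 0" and f: "\<And>z. z \<in> right_triangle p q h k \<Longrightarrow> f z = c + a \<bullet> z"
  shows "(f has_integral \<bar>h * k\<bar> / 6 * (f (p, q) + f (p + h, q) + f (p, q + k))) (right_triangle p q h k)"
proof -
  let ?T = "right_triangle p q h k" and ?S = "{z::real\<times>real. 0 \<le> fst z \<and> 0 \<le> snd z \<and> fst z + snd z \<le> 1}"
  define g where "g = (\<lambda>z. indicator ?T z *\<^sub>R (c + a \<bullet> z))"
  have g: "integrable lborel g"
    unfolding g_def by (intro borel_integrable_compact compact_right_triangle continuous_intros)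
  have verts: "(p, q) \<in> ?T" "(p + h, q) \<in> ?T" "(p, q + k) \<in> ?T"
    by (auto simp: right_triangle_def intro: hull_inc)
  have g_aff: "g (p + h * s, q + k * t) =
      indicator ?S (s, t) * ((c + a \<bullet> (p, q)) + (h * fst a) * s + (k * snd a) * t)" for s t
    using right_triangle_iff[OF assms(1,2), of p s q t]
    by (auto simp: g_def indicator_def inner_prod_def algebra_simps)
  have "integral\<^sup>L lborel g = (LINT s|lborel. LINT t|lborel. g (s, t))"
    using lborel_pair.integral_fst'[of g] g by (simp add: lborel_prod)
  also have "\<dots> = (LINT s|lborel. \<bar>h\<bar> * (LINT t|lborel. g (p + h * s, t)))"
    using lborel_integral_real_affine[OF assms(1), of "\<lambda>s. LINT t|lborel. g (s, t)" p] by simp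
  also have "\<dots> = \<bar>h\<bar> * (LINT s|lborel. \<bar>k\<bar> * (LINT t|lborel. g (p + h * s, q + k * t)))"
    using lborel_integral_real_affine[OF assms(2), of "\<lambda>t. g (p + h * s, t)" q for s] by simp
  also have "\<dots> = \<bar>h * k\<bar> * ((c + a \<bullet> (p, q)) / 2 + (h * fst a) / 6 + (k * snd a) / 6)"
    unfolding g_aff by (simp only: integral_mult_right_zero integral_standard_triangle) (simp add: abs_mult)
  also have "\<dots> = \<bar>h * k\<bar> / 6 * (f (p, q) + f (p + h, q) + f (p, q + k))"
    using verts by (simp add: f inner_prod_def algebra_simps)
  finally have "(g has_integral \<bar>h * k\<bar> / 6 * (f (p, q) + f (p + h, q) + f (p, q + k))) UNIV"
    using has_integral_integral_lborel[OF g] by (simp only:)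
  moreover have "g = (\<lambda>z. if z \<in> ?T then f z else 0)"
    by (auto simp: g_def f)
  ultimately show ?thesis
    by (simp add: has_integral_restrict_UNIV)
qed

section \<open>Gradients and edge fluxes of functions affine on a triangle\<close>

lemma grad_affine_interior:
  assumes "\<And>z. z \<in> K \<Longrightarrow> f z = c + a \<bullet> z" and "z \<in> interior K"
  shows "grad f z = a"
proof -
  have "((\<lambda>z. c + a \<bullet> z) has_derivative (\<lambda>h. a \<bullet> h)) (at z)"
    by (auto intro!: derivative_eq_intros)
  then have "(f has_derivative (\<lambda>h. a \<bullet> h)) (at z)"
    using assms interior_subset[of K]
    by (elim has_derivative_transform_within_open[where s = "interior K"]) auto
  then have "frechet_derivative f (at z) = (\<lambda>h. a \<bullet> h)"
    by (metis frechet_derivative_at)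
  then show ?thesis
    by (simp add: grad_def inner_prod_def)
qed

text \<open>The integral of \<open>w\<^sup>2 / 2 du\<close> along the segment from \<open>P\<close> to \<open>Q\<close>, for \<open>u\<close> and \<open>w\<close> affine on it.\<close>

definition edge_flux :: "('a \<Rightarrow> real) \<Rightarrow> ('a \<Rightarrow> real) \<Rightarrow> 'a \<Rightarrow> 'a \<Rightarrow> real"
  where "edge_flux u w P Q = (u Q - u P) * ((w P)\<^sup>2 + w P * w Q + (w Q)\<^sup>2) / 6"

lemma edge_flux_commute: "edge_flux u w Q P = - edge_flux u w P Q"
  unfolding edge_flux_def by (simp add: field_simps power2_eq_square)

text \<open>Green's formula as a polynomial identity: the difference of products is the Jacobian of
  \<open>(u, w)\<close> times twice the signed area, so the left side is the integral of
  \<open>w du \<and> dw\<close> over a positively oriented triangle \<open>P\<close>,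
  \<open>Q\<close>, \<open>R\<close>.\<close>

lemma edge_flux_triangle:
  "((u Q - u P) * (w R - w P) - (u R - u P) * (w Q - w P)) * (w P + w Q + w R) / 6
    = - (edge_flux u w P Q + edge_flux u w Q R + edge_flux u w R P)"
  unfolding edge_flux_def by (simp add: field_simps power2_eq_square)

text \<open>Inside the triangle the integrand is a constant Jacobian times the affine function
  \<open>w\<close>, so the vertex rule and \<open>edge_flux_triangle\<close> apply. The factor
  \<open>sgn (h * k)\<close> is the orientation of the listed vertices.\<close>

lemma has_integral_trilinear_right_triangle:
  assumes hk: "h \<noteq> 0" "k \<noteq> 0"
    and u: "\<exists>c a. \<forall>z\<in>right_triangle p q h k. u z = c + a \<bullet> z"
    and w: "\<exists>c a. \<forall>z\<in>right_triangle p q h k. w z = c + a \<bullet> z"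
  shows "((\<lambda>z. (vec_V (grad u) z \<bullet> grad w z) * w z) has_integral
     - sgn (h * k) * (edge_flux u w (p, q) (p + h, q) + edge_flux u w (p + h, q) (p, q + k)
        + edge_flux u w (p, q + k) (p, q))) (right_triangle p q h k)"
proof -
  let ?T = "right_triangle p q h k"
  obtain c a where u: "\<And>z. z \<in> ?T \<Longrightarrow> u z = c + a \<bullet> z" using u by blast
  obtain d b where w: "\<And>z. z \<in> ?T \<Longrightarrow> w z = d + b \<bullet> z" using w by blast
  have verts: "(p, q) \<in> ?T" "(p + h, q) \<in> ?T" "(p, q + k) \<in> ?T"
    by (auto simp: right_triangle_def intro: hull_inc)
  have "\<bar>h * k\<bar> = sgn (h * k) * (h * k)"
    by (simp add: abs_sgn mult.commute)
  then have "(fst a * snd b - snd a * fst b) * (\<bar>h * k\<bar> / 6 * (w (p, q) + w (p + h, q) + w (p, q + k))) =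
     sgn (h * k) / 6 * ((h * fst a) * (k * snd b) - (k * snd a) * (h * fst b))
     * (w (p, q) + w (p + h, q) + w (p, q + k))"
    by (simp add: field_simps)
  \<comment> \<open>Legs times gradient components are vertex increments, which brings the integral
    into the form of \<open>edge_flux_triangle\<close>.\<close>
  moreover have "h * fst a = u (p + h, q) - u (p, q)" "k * snd b = w (p, q + k) - w (p, q)"
      "k * snd a = u (p, q + k) - u (p, q)" "h * fst b = w (p + h, q) - w (p, q)"
    using verts by (simp_all add: u w inner_prod_def algebra_simps)
  ultimately have eq: "(fst a * snd b - snd a * fst b) * (\<bar>h * k\<bar> / 6 * (w (p, q) + w (p + h, q) + w (p, q + k))) =
     sgn (h * k) * (((u (p + h, q) - u (p, q)) * (w (p, q + k) - w (p, q))
        - (u (p, q + k) - u (p, q)) * (w (p + h, q) - w (p, q)))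
     * (w (p, q) + w (p + h, q) + w (p, q + k)) / 6)"
    by simp
  have int: "((\<lambda>z. (fst a * snd b - snd a * fst b) * w z) has_integral
      (fst a * snd b - snd a * fst b) * (\<bar>h * k\<bar> / 6 * (w (p, q) + w (p + h, q) + w (p, q + k)))) ?T"
    by (rule has_integral_mult_right) (rule has_integral_affine_right_triangle[OF hk w])
  have "(vec_V (grad u) z \<bullet> grad w z) * w z = (fst a * snd b - snd a * fst b) * w z"
    if "z \<in> ?T - frontier ?T" for z
  proof -
    have "z \<in> interior ?T"
      using that closure_subset[of ?T] by (auto simp: frontier_def)
    then show ?thesis
      using grad_affine_interior[OF u] grad_affine_interior[OF w]
      by (simp add: vec_V_def inner_prod_def)
  qed
  \<comment> \<open>The gradients are known only off the edges, which form a null set.\<close>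
  from has_integral_spike[OF negligible_frontier_right_triangle[of p q h k] this int] show ?thesis
    unfolding eq edge_flux_triangle by (simp only: mult_minus_left mult_minus_right)
qed

lemma integrable_grad_right_triangle:
  assumes "\<exists>c a. \<forall>z\<in>right_triangle p q h k. u z = c + a \<bullet> z"
  shows "(\<lambda>z. grad u z \<bullet> e) integrable_on right_triangle p q h k"
    and "\<exists>a. \<forall>z\<in>right_triangle p q h k - frontier (right_triangle p q h k). grad u z = a"
proof -
  let ?T = "right_triangle p q h k"
  obtain c a where u: "\<And>z. z \<in> ?T \<Longrightarrow> u z = c + a \<bullet> z" using assms by blast
  have grad: "grad u z = a" if "z \<in> ?T - frontier ?T" for z
    using that grad_affine_interior[of ?T u c a z, OF u] closure_subset[of ?T]
    by (auto simp: frontier_def)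
  then show "\<exists>a. \<forall>z\<in>?T - frontier ?T. grad u z = a" by blast
  have "(\<lambda>z. a \<bullet> e) integrable_on ?T"
    by (intro integrable_on_const lmeasurable_compact compact_right_triangle)
  then show "(\<lambda>z. grad u z \<bullet> e) integrable_on ?T"
    by (rule integrable_spike[OF _ negligible_frontier_right_triangle[of p q h k]]) (simp add: grad)
qed

section \<open>Grids\<close>

text \<open>Each half of a cell has its right angle at the corner off the diagonal; the legs are
  measured from there.\<close>

lemma split_cell_right_triangle:
  "split_cell a b c d \<delta> =
    (if \<delta> then {right_triangle b c (a - b) (d - c), right_triangle a d (b - a) (c - d)}
     else {right_triangle a c (b - a) (d - c), right_triangle b d (a - b) (c - d)})"
  by (auto simp: split_cell_def right_triangle_def insert_commute)

lemma mem_right_triangle_iff: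
  assumes "h \<noteq> 0" "k \<noteq> 0"
  shows "z \<in> right_triangle p q h k \<longleftrightarrow>
    0 \<le> (fst z - p) / h \<and> 0 \<le> (snd z - q) / k \<and> (fst z - p) / h + (snd z - q) / k \<le> 1"
  using right_triangle_iff[OF assms, of p "(fst z - p) / h" q "(snd z - q) / k"] assms by simp

text \<open>The second triangle is the first one reflected in the midpoint of the hypotenuse. In
  coordinates scaled by the legs the two are the parts of the unit square below and above the line s
  + t = 1, so they meet on a line.\<close>

lemma right_triangles_cover:
  assumes "h \<noteq> 0" "k \<noteq> 0"
  shows "right_triangle p q h k \<union> right_triangle (p + h) (q + k) (- h) (- k) =
      {z. (fst z - p) / h \<in> {0..1} \<and> (snd z - q) / k \<in> {0..1}}"
    and "negligible (right_triangle p q h k \<inter> right_triangle (p + h) (q + k) (- h) (- k))"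
proof -
  have eq: "z \<in> right_triangle (p + h) (q + k) (- h) (- k) \<longleftrightarrow>
      (fst z - p) / h \<le> 1 \<and> (snd z - q) / k \<le> 1 \<and> 1 \<le> (fst z - p) / h + (snd z - q) / k" for z
  proof -
    have "(fst z - (p + h)) / - h = 1 - (fst z - p) / h" "(snd z - (q + k)) / - k = 1 - (snd z - q) / k"
      using assms by (simp_all add: field_simps)
    moreover have "- h \<noteq> 0" "- k \<noteq> 0" using assms by auto
    ultimately show ?thesis
      by (auto simp: mem_right_triangle_iff)
  qed
  show "right_triangle p q h k \<union> right_triangle (p + h) (q + k) (- h) (- k) =
      {z. (fst z - p) / h \<in> {0..1} \<and> (snd z - q) / k \<in> {0..1}}"
    unfolding set_eq_iff Un_iff eq mem_right_triangle_iff[OF assms] by auto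
  have "(1 / h, 1 / k) \<bullet> z = 1 + p / h + q / k"
    if "z \<in> right_triangle p q h k \<inter> right_triangle (p + h) (q + k) (- h) (- k)" for z
  proof -
    have "(fst z - p) / h + (snd z - q) / k = 1"
      using that unfolding Int_iff eq mem_right_triangle_iff[OF assms] by linarith
    then show ?thesis by (simp add: inner_prod_def diff_divide_distrib)
  qed
  then have "right_triangle p q h k \<inter> right_triangle (p + h) (q + k) (- h) (- k) \<subseteq>
      {z. (1 / h, 1 / k) \<bullet> z = 1 + p / h + q / k}"
    by blast
  then show "negligible (right_triangle p q h k \<inter> right_triangle (p + h) (q + k) (- h) (- k))"
    by (rule negligible_subset[rotated]) (rule negligible_hyperplane, use assms in \<open>auto simp: zero_prod_def\<close>)
qed

lemma unit_interval_rescale: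
  fixes a b s :: real
  assumes "a < b"
  shows "(s - a) / (b - a) \<in> {0..1} \<longleftrightarrow> s \<in> {a..b}" and "(s - b) / (a - b) \<in> {0..1} \<longleftrightarrow> s \<in> {a..b}"
proof -
  show *: "(s - a) / (b - a) \<in> {0..1} \<longleftrightarrow> s \<in> {a..b}"
    using assms by (simp add: zero_le_divide_iff divide_le_eq_1)
  have "(s - b) / (a - b) = 1 - (s - a) / (b - a)"
    using assms by (simp add: divide_simps) (simp add: algebra_simps)
  then show "(s - b) / (a - b) \<in> {0..1} \<longleftrightarrow> s \<in> {a..b}"
    using * by auto
qed

text \<open>Treats both diagonals at once; the equations for \<open>p\<close>, \<open>q\<close>,
  \<open>h\<close> and \<open>k\<close> are kept because the sign of \<open>h * k\<close> and the
  vertices are needed for the fluxes.\<close>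

lemma split_cell_cover:
  assumes "a < b" "c < d"
  obtains p q h k where "split_cell a b c d \<delta> = {right_triangle p q h k, right_triangle (p + h) (q + k) (- h) (- k)}"
    "cbox (a, c) (b, d) = right_triangle p q h k \<union> right_triangle (p + h) (q + k) (- h) (- k)"
    "h \<noteq> 0" "k \<noteq> 0" "p = (if \<delta> then b else a)" "h = (if \<delta> then a - b else b - a)" "q = c" "k = d - c"
proof -
  define p h where "p = (if \<delta> then b else a)" and "h = (if \<delta> then a - b else b - a)"
  have nz: "h \<noteq> 0" "d - c \<noteq> 0" using assms by (auto simp: h_def)
  have "right_triangle p c h (d - c) \<union> right_triangle (p + h) (c + (d - c)) (- h) (- (d - c)) =
     {z. fst z \<in> {a..b} \<and> snd z \<in> {c..d}}"
    unfolding right_triangles_cover(1)[OF nz] unfolding p_def h_def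
    by (cases \<delta>) (simp_all only: unit_interval_rescale[OF assms(1)] unit_interval_rescale(1)[OF assms(2)] if_True if_False)
  also have "\<dots> = cbox (a, c) (b, d)"
    by (auto simp: cbox_Pair_eq)
  finally have cover: "cbox (a, c) (b, d) =
      right_triangle p c h (d - c) \<union> right_triangle (p + h) (c + (d - c)) (- h) (- (d - c))" ..
  have "split_cell a b c d \<delta> = {right_triangle p c h (d - c), right_triangle (p + h) (c + (d - c)) (- h) (- (d - c))}"
    unfolding split_cell_right_triangle p_def h_def by simp
  then show ?thesis
    using cover nz p_def h_def refl refl by (rule that)
qed

text \<open>The flux through the diagonal cancels between the two triangles. What remains is minus
  the counterclockwise flux along the cell boundary, written with edges pointing right or
  up.\<close>

lemma has_integral_trilinear_cell:
  assumes "a < b" "c < d"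
    and u: "\<forall>K\<in>split_cell a b c d \<delta>. \<exists>c a. \<forall>z\<in>K. u z = c + a \<bullet> z"
    and w: "\<forall>K\<in>split_cell a b c d \<delta>. \<exists>c a. \<forall>z\<in>K. w z = c + a \<bullet> z"
  shows "((\<lambda>z. (vec_V (grad u) z \<bullet> grad w z) * w z) has_integral
     edge_flux u w (a, d) (b, d) - edge_flux u w (a, c) (b, c)
     - (edge_flux u w (b, c) (b, d) - edge_flux u w (a, c) (a, d)))
     (cbox (a, c) (b, d))"
proof -
  obtain p q h k where T: "split_cell a b c d \<delta> = {right_triangle p q h k, right_triangle (p + h) (q + k) (- h) (- k)}"
    "cbox (a, c) (b, d) = right_triangle p q h k \<union> right_triangle (p + h) (q + k) (- h) (- k)"
    "h \<noteq> 0" "k \<noteq> 0" "p = (if \<delta> then b else a)" "h = (if \<delta> then a - b else b - a)" "q = c" "k = d - c"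
    by (rule split_cell_cover[OF assms(1,2), of \<delta>])
  have nz: "- h \<noteq> 0" "- k \<noteq> 0" using T(3,4) by auto
  have sgn: "sgn (h * k) = (if \<delta> then - 1 else 1)"
    using assms(1,2) by (auto simp: T(5-8) sgn_mult)
  have aff: "\<exists>c a. \<forall>z\<in>right_triangle p q h k. u z = c + a \<bullet> z"
    "\<exists>c a. \<forall>z\<in>right_triangle p q h k. w z = c + a \<bullet> z"
    "\<exists>c a. \<forall>z\<in>right_triangle (p + h) (q + k) (- h) (- k). u z = c + a \<bullet> z"
    "\<exists>c a. \<forall>z\<in>right_triangle (p + h) (q + k) (- h) (- k). w z = c + a \<bullet> z"
    using u w unfolding T(1) by blast+
  note int = has_integral_Un[OF has_integral_trilinear_right_triangle[OF T(3,4) aff(1,2)]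
        has_integral_trilinear_right_triangle[OF nz aff(3,4)] right_triangles_cover(2)[OF T(3,4)]]
  \<comment> \<open>Point reflection preserves orientation, so both triangles carry the same sign
    and traverse the diagonal in opposite directions.\<close>
  have sgn': "sgn (- h * - k) = sgn (h * k)" by simp
  have y: "q = c" "c + k = d" "d + - k = c" using T(7,8) by auto
  show ?thesis
  proof (cases \<delta>)
    case True
    then have x: "p = b" "b + h = a" "a + - h = b" "sgn (h * k) = - 1"
      using T(5,6) sgn by auto
    show ?thesis
      unfolding T(2) using int unfolding sgn' x y
      by (rule has_integral_eq_rhs)
        (simp add: edge_flux_commute[of u w "(b, c)" "(a, c)"] edge_flux_commute[of u w "(b, d)" "(a, c)"]
          edge_flux_commute[of u w "(b, d)" "(b, c)"])
  next
    case False
    then have x: "p = a" "a + h = b" "b + - h = a" "sgn (h * k) = 1"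
      using T(5,6) sgn by auto
    show ?thesis
      unfolding T(2) using int unfolding sgn' x y
      by (rule has_integral_eq_rhs)
        (simp add: edge_flux_commute[of u w "(b, d)" "(a, d)"] edge_flux_commute[of u w "(b, c)" "(a, d)"]
          edge_flux_commute[of u w "(a, d)" "(a, c)"])
  qed
qed

section \<open>Assembling cell integrals over the grid\<close>

lemma sum_Suc_diff_periodic:
  fixes f :: "nat \<Rightarrow> real"
  assumes "1 \<le> n" "f n = f 1"
  shows "(\<Sum>i=1..<n. f (Suc i) - f i) = 0"
  using sum_Suc_diff'[of 1 n f] assms by simp

text \<open>Serves twice: to stack cells into a strip and to join strips into the square. The chain
  starts from a degenerate rectangle, hence the null set \<open>A 1\<close>.\<close>

lemma has_integral_Un_chain:
  fixes f :: "'a::euclidean_space \<Rightarrow> real"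
  assumes "1 \<le> n" "negligible (A 1)"
    and "\<And>i. i \<in> {1..<n} \<Longrightarrow> A (Suc i) = A i \<union> C i"
    and "\<And>i. i \<in> {1..<n} \<Longrightarrow> negligible (A i \<inter> C i)"
    and "\<And>i. i \<in> {1..<n} \<Longrightarrow> (f has_integral I i) (C i)"
  shows "(f has_integral (\<Sum>i=1..<n. I i)) (A n)"
  using assms
proof (induction n rule: dec_induct)
  case base
  then show ?case by (auto intro: has_integral_negligible)
next
  case (step m)
  then show ?case
    by (auto simp: less_Suc_eq intro!: has_integral_Un)
qed

lemma grid_mono:
  assumes "grid L n x"
  shows "i \<in> {1..<n} \<Longrightarrow> x i < x (Suc i)" "i \<in> {1..n} \<Longrightarrow> x i \<in> {0..L}"
proof -
  have *: "x i < x j" if "1 \<le> i" "i < j" "j \<le> n" for i j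
    using assms that by (auto simp: grid_def strict_mono_on_def)
  then show "i \<in> {1..<n} \<Longrightarrow> x i < x (Suc i)" by auto
  have "x 1 \<le> x i \<and> x i \<le> x n" if "i \<in> {1..n}"
    using that *[of 1 i] *[of i n] by (cases "i = 1"; cases "i = n") force+
  then show "i \<in> {1..n} \<Longrightarrow> x i \<in> {0..L}"
    using assms by (auto simp: grid_def)
qed

lemma has_integral_grid:
  fixes f :: "real \<times> real \<Rightarrow> real"
  assumes x: "grid L n x" and y: "grid L n y"
    and f: "\<And>i j. i \<in> {1..<n} \<Longrightarrow> j \<in> {1..<n} \<Longrightarrow>
      (f has_integral I i j) (cbox (x i, y j) (x (Suc i), y (Suc j)))"
  shows "(f has_integral (\<Sum>i=1..<n. \<Sum>j=1..<n. I i j)) (cbox (0, 0) (L, L))"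
proof -
  have n: "1 \<le> n" "x 1 = 0" "y 1 = 0" "x n = L" "y n = L"
    using x y by (auto simp: grid_def)
  have "(f has_integral (\<Sum>j=1..<n. I i j)) (cbox (x i, 0) (x (Suc i), L))" if i: "i \<in> {1..<n}" for i
  proof -
    have "(f has_integral (\<Sum>j=1..<n. I i j)) (cbox (x i, 0) (x (Suc i), y n))"
    proof (rule has_integral_Un_chain[where C = "\<lambda>j. cbox (x i, y j) (x (Suc i), y (Suc j))" and A = "\<lambda>j. cbox (x i, 0) (x (Suc i), y j)"])
      fix j assume j: "j \<in> {1..<n}"
      have *: "0 \<le> y j" "y j < y (Suc j)"
        using grid_mono[OF y] j by auto
      show "cbox (x i, 0) (x (Suc i), y (Suc j)) =
          cbox (x i, 0) (x (Suc i), y j) \<union> cbox (x i, y j) (x (Suc i), y (Suc j))"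
        using * by (auto simp: cbox_Pair_eq)
      show "negligible (cbox (x i, 0) (x (Suc i), y j) \<inter> cbox (x i, y j) (x (Suc i), y (Suc j)))"
        by (rule negligible_subset[OF negligible_hyperplane[of "(0, 1)" "y j"]])
           (auto simp: cbox_Pair_eq zero_prod_def)
    next
      show "negligible (cbox (x i, 0) (x (Suc i), y 1))"
        by (rule negligible_subset[OF negligible_hyperplane[of "(0, 1)" "y 1"]])
           (use n in \<open>auto simp: cbox_Pair_eq zero_prod_def\<close>)
    qed (use n f i in auto)
    then show ?thesis by (simp add: n)
  qed
  note strip = this
  have "(f has_integral (\<Sum>i=1..<n. \<Sum>j=1..<n. I i j)) (cbox (0, 0) (x n, L))"
  proof (rule has_integral_Un_chain[where C = "\<lambda>i. cbox (x i, 0) (x (Suc i), L)" and A = "\<lambda>i. cbox (0, 0) (x i, L)"])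
    fix i assume i: "i \<in> {1..<n}"
    have *: "0 \<le> x i" "x i < x (Suc i)"
      using grid_mono[OF x] i by auto
    show "cbox (0, 0) (x (Suc i), L) = cbox (0, 0) (x i, L) \<union> cbox (x i, 0) (x (Suc i), L)"
      using * by (auto simp: cbox_Pair_eq)
    show "negligible (cbox (0, 0) (x i, L) \<inter> cbox (x i, 0) (x (Suc i), L))"
      by (rule negligible_subset[OF negligible_hyperplane[of "(1, 0)" "x i"]])
         (auto simp: cbox_Pair_eq zero_prod_def)
  next
    show "negligible (cbox (0, 0) (x 1, L))"
      by (rule negligible_subset[OF negligible_hyperplane[of "(1, 0)" "x 1"]])
         (use n in \<open>auto simp: cbox_Pair_eq zero_prod_def\<close>)
  qed (use n strip in auto)
  then show ?thesis by (simp add: n)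
qed

lemma grid_cover:
  assumes "grid L n x" "0 \<le> s" "s < L"
  obtains i where "i \<in> {1..<n}" "s \<in> {x i..x (Suc i)}"
proof -
  \<comment> \<open>Minimality of \<open>i\<close> gives \<open>x i \<le> s\<close>. It needs
    \<open>i \<noteq> 0\<close>, which holds since the nodes start at index 1 with
    \<open>x 1 = 0 \<le> s\<close>; the index \<open>n - 1\<close> shows that some candidate
    exists.\<close>
  define i where "i = (LEAST i. s < x (Suc i))"
  have n: "2 \<le> n" "x 1 = 0" "x n = L" using assms by (auto simp: grid_def)
  have "s < x (Suc (n - 1))" using assms n by simp
  then have "s < x (Suc i)" "i \<le> n - 1"
    unfolding i_def by (auto intro: LeastI Least_le)
  moreover have "i \<noteq> 0"
  proof
    assume "i = 0"
    with \<open>s < x (Suc i)\<close> n assms(2) show False by simp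
  qed
  moreover have "\<not> s < x (Suc (i - 1))"
    using \<open>i \<noteq> 0\<close> unfolding i_def by (intro not_less_Least) (auto simp: i_def)
  ultimately show ?thesis
    using n by (intro that[of i]) auto
qed

section \<open>Finite elements on the triangulated square\<close>

lemma square_eq_box: "square L = box (0, 0) (L, L)"
  by (auto simp: square_def mem_box Basis_prod_def)

lemma square_lmeasurable: "square L \<in> lmeasurable"
  by (simp add: square_eq_box)

locale triangulated_square =
  fixes L :: real and n :: nat and x y :: "nat \<Rightarrow> real" and \<T> :: "(real \<times> real) set set"
  assumes x: "grid L n x" and y: "grid L n y" and tri: "structured_triangulation n x y \<T>"
begin

lemma L_pos: "0 < L"
proof -
  have "2 \<le> n" "x 1 = 0" "x n = L" "strict_mono_on {1..n} x"
    using x by (auto simp: grid_def)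
  then show ?thesis
    using strict_mono_onD[of "{1..n}" x 1 n] by simp
qed

lemma closure_square: "closure (square L) = cbox (0, 0) (L, L)"
proof -
  have "(L / 2, L / 2) \<in> box (0, 0) (L, L)"
    using L_pos by (simp add: mem_box Basis_prod_def)
  then show ?thesis
    unfolding square_eq_box by (intro closure_box) auto
qed

lemma cells:
  obtains \<delta> where "\<T> = (\<Union>i\<in>{1..<n}. \<Union>j\<in>{1..<n}. split_cell (x i) (x (Suc i)) (y j) (y (Suc j)) (\<delta> i j))"
  using tri by (auto simp: structured_triangulation_def)

lemma cell_nondegenerate: "i \<in> {1..<n} \<Longrightarrow> x i < x (Suc i)" "i \<in> {1..<n} \<Longrightarrow> y i < y (Suc i)"
  using grid_mono x y by blast+

lemma Linf_X_N:
  assumes "f \<in> X_N L \<T>"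
  shows "f \<in> Linf (square L)"
proof -
  have cont: "continuous_on (cbox (0, 0) (L, L)) f"
    using assms by (simp add: X_N_def closure_square)
  then have "compact (f ` cbox (0, 0) (L, L))"
    by (intro compact_continuous_image compact_cbox)
  then obtain C where C: "\<And>z. z \<in> cbox (0, 0) (L, L) \<Longrightarrow> \<bar>f z\<bar> \<le> C"
    by (force dest: compact_imp_bounded simp: bounded_iff)
  have sub: "square L \<subseteq> cbox (0, 0) (L, L)"
    by (simp add: square_eq_box box_subset_cbox)
  have "f \<in> borel_measurable (lebesgue_on (square L))"
    using continuous_on_subset[OF cont sub] square_lmeasurable
    by (intro continuous_imp_measurable_on_sets_lebesgue) auto
  moreover have "AE z in lebesgue_on (square L). \<bar>f z\<bar> \<le> C"
    using C sub by (intro AE_I2) (auto simp: space_restrict_space)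
  ultimately show ?thesis
    unfolding Linf_iff by blast
qed

lemma triangulation_right_triangles:
  assumes "K \<in> \<T>"
  obtains p q h k where "K = right_triangle p q h k"
proof -
  obtain \<delta> where "\<T> = (\<Union>i\<in>{1..<n}. \<Union>j\<in>{1..<n}. split_cell (x i) (x (Suc i)) (y j) (y (Suc j)) (\<delta> i j))"
    by (rule cells)
  with assms that show ?thesis
    by (auto simp: split_cell_right_triangle split: if_splits)
qed

lemma finite_triangulation: "finite \<T>"
proof -
  obtain \<delta> where "\<T> = (\<Union>i\<in>{1..<n}. \<Union>j\<in>{1..<n}. split_cell (x i) (x (Suc i)) (y j) (y (Suc j)) (\<delta> i j))"
    by (rule cells)
  then show ?thesis by (simp add: split_cell_def)
qed

lemma square_subset_triangulation: "square L \<subseteq> \<Union>\<T>"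
proof
  fix z assume z: "z \<in> square L"
  obtain \<delta> where \<T>: "\<T> = (\<Union>i\<in>{1..<n}. \<Union>j\<in>{1..<n}. split_cell (x i) (x (Suc i)) (y j) (y (Suc j)) (\<delta> i j))"
    by (rule cells)
  obtain i where i: "i \<in> {1..<n}" "fst z \<in> {x i..x (Suc i)}"
    by (rule grid_cover[OF x, of "fst z"]) (use z in \<open>auto simp: square_def\<close>)
  obtain j where j: "j \<in> {1..<n}" "snd z \<in> {y j..y (Suc j)}"
    by (rule grid_cover[OF y, of "snd z"]) (use z in \<open>auto simp: square_def\<close>)
  have "z \<in> cbox (x i, y j) (x (Suc i), y (Suc j))"
    using i j by (cases z) (auto simp: cbox_Pair_eq)
  also obtain p q h k where
    c: "split_cell (x i) (x (Suc i)) (y j) (y (Suc j)) (\<delta> i j) =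
        {right_triangle p q h k, right_triangle (p + h) (q + k) (- h) (- k)}"
    "cbox (x i, y j) (x (Suc i), y (Suc j)) =
        right_triangle p q h k \<union> right_triangle (p + h) (q + k) (- h) (- k)"
    by (rule split_cell_cover[OF cell_nondegenerate(1)[OF i(1)] cell_nondegenerate(2)[OF j(1)], of "\<delta> i j"]) (rule that)
  from c have "cbox (x i, y j) (x (Suc i), y (Suc j)) =
      \<Union>(split_cell (x i) (x (Suc i)) (y j) (y (Suc j)) (\<delta> i j))"
    by simp
  also have "\<dots> \<subseteq> \<Union>\<T>"
    using i j unfolding \<T> by blast
  finally show "z \<in> \<Union>\<T>" .
qed

text \<open>Supplies the measurability of the gradient for \<open>Linf_grad\<close>: gauge
  integrability tolerates unspecified values on edges and is glued cell by cell.\<close>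

lemma integrable_grad:
  assumes f: "f \<in> X_N L \<T>"
  shows "(\<lambda>z. grad f z \<bullet> e) integrable_on square L"
proof -
  obtain \<delta> where \<T>: "\<T> = (\<Union>i\<in>{1..<n}. \<Union>j\<in>{1..<n}. split_cell (x i) (x (Suc i)) (y j) (y (Suc j)) (\<delta> i j))"
    by (rule cells)
  have "(\<lambda>z. grad f z \<bullet> e) integrable_on cbox (x i, y j) (x (Suc i), y (Suc j))"
    if i: "i \<in> {1..<n}" and j: "j \<in> {1..<n}" for i j
  proof -
    obtain p q h k where c:
      "split_cell (x i) (x (Suc i)) (y j) (y (Suc j)) (\<delta> i j) =
        {right_triangle p q h k, right_triangle (p + h) (q + k) (- h) (- k)}"
      "cbox (x i, y j) (x (Suc i), y (Suc j)) =
        right_triangle p q h k \<union> right_triangle (p + h) (q + k) (- h) (- k)" "h \<noteq> 0" "k \<noteq> 0"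
      by (rule split_cell_cover[OF cell_nondegenerate(1)[OF i] cell_nondegenerate(2)[OF j], of "\<delta> i j"]) (rule that)
    have "split_cell (x i) (x (Suc i)) (y j) (y (Suc j)) (\<delta> i j) \<subseteq> \<T>"
      using i j unfolding \<T> by blast
    then have "\<forall>K\<in>split_cell (x i) (x (Suc i)) (y j) (y (Suc j)) (\<delta> i j). \<exists>c a. \<forall>z\<in>K. f z = c + a \<bullet> z"
      using f by (auto simp: X_N_def)
    then show ?thesis
      unfolding c by (intro integrable_Un integrable_grad_right_triangle right_triangles_cover(2) c(3,4)) auto
  qed
  then have "((\<lambda>z. grad f z \<bullet> e) has_integral (\<Sum>i=1..<n. \<Sum>j=1..<n.
      integral (cbox (x i, y j) (x (Suc i), y (Suc j))) (\<lambda>z. grad f z \<bullet> e))) (cbox (0, 0) (L, L))"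
    by (intro has_integral_grid[OF x y] integrable_integral)
  then show ?thesis
    unfolding square_eq_box integrable_on_open_interval by blast
qed

text \<open>Off the edges the gradient takes one value per triangle, and there are finitely many
  triangles.\<close>

lemma Linf_grad:
  assumes f: "f \<in> X_N L \<T>"
  shows "(\<lambda>z. grad f z \<bullet> e) \<in> Linf (square L)"
proof -
  have "\<exists>a. \<forall>z\<in>K - frontier K. grad f z = a" if K: "K \<in> \<T>" for K
  proof -
    have "\<exists>c a. \<forall>z\<in>K. f z = c + a \<bullet> z"
      using f K by (simp add: X_N_def)
    moreover obtain p q h k where "K = right_triangle p q h k"
      using K by (rule triangulation_right_triangles)
    ultimately show ?thesis
      using integrable_grad_right_triangle(2)[of p q h k f] by simp
  qed
  then have "\<forall>K. \<exists>a. K \<in> \<T> \<longrightarrow> (\<forall>z\<in>K - frontier K. grad f z = a)"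
    by blast
  then obtain g where g: "\<And>K z. K \<in> \<T> \<Longrightarrow> z \<in> K - frontier K \<Longrightarrow> grad f z = g K"
    using choice[of "\<lambda>K a. K \<in> \<T> \<longrightarrow> (\<forall>z\<in>K - frontier K. grad f z = a)"] by blast
  let ?N = "\<Union>K\<in>\<T>. frontier K"
  have "negligible (frontier K)" if "K \<in> \<T>" for K
    by (rule triangulation_right_triangles[OF that]) (simp add: negligible_frontier_right_triangle)
  then have "negligible ?N"
    by (intro negligible_Union finite_imageI finite_triangulation) auto
  then have "AE z in lebesgue. z \<notin> ?N"
    by (intro AE_not_in) (simp add: negligible_iff_null_sets)
  \<comment> \<open>The sum over all triangles is a convenient upper bound for each elementwise
    value.\<close>
  moreover have "\<bar>grad f z \<bullet> e\<bar> \<le> (\<Sum>K\<in>\<T>. \<bar>g K \<bullet> e\<bar>)" if z: "z \<in> square L" "z \<notin> ?N" for z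
  proof -
    obtain K where K: "K \<in> \<T>" "z \<in> K"
      using z square_subset_triangulation by blast
    then have "grad f z = g K"
      using g z by blast
    then show ?thesis
      using member_le_sum[OF K(1), of "\<lambda>K. \<bar>g K \<bullet> e\<bar>"] finite_triangulation by simp
  qed
  ultimately have "AE z in lebesgue_on (square L). \<bar>grad f z \<bullet> e\<bar> \<le> (\<Sum>K\<in>\<T>. \<bar>g K \<bullet> e\<bar>)"
    using square_lmeasurable[of L] by (subst AE_restrict_space_iff) (auto elim!: eventually_mono)
  moreover have "(\<lambda>z. grad f z \<bullet> e) \<in> borel_measurable (lebesgue_on (square L))"
    using integrable_imp_measurable[OF integrable_grad[OF f]] .
  ultimately show ?thesis
    unfolding Linf_iff by blast
qed

text \<open>Summed over the grid, the cell fluxes telescope: horizontal edges \<open>H\<close> in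
  \<open>j\<close>, vertical edges \<open>V\<close> in \<open>i\<close>. Periodicity identifies the
  first and last terms.\<close>

lemma trilinear_eq_0:
  assumes u: "u \<in> X_NP L \<T>" and w: "w \<in> X_NP L \<T>"
  shows "L2_inner (square L) (\<lambda>z. vec_V (grad u) z \<bullet> grad w z) w = 0"
proof -
  let ?F = "\<lambda>z. (vec_V (grad u) z \<bullet> grad w z) * w z"
  have uN: "u \<in> X_N L \<T>" and wN: "w \<in> X_N L \<T>"
    using u w by (auto simp: X_NP_def)
  obtain \<delta> where \<T>: "\<T> = (\<Union>i\<in>{1..<n}. \<Union>j\<in>{1..<n}. split_cell (x i) (x (Suc i)) (y j) (y (Suc j)) (\<delta> i j))"
    by (rule cells)
  define H where "H i j = edge_flux u w (x i, y j) (x (Suc i), y j)" for i j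
  define V where "V i j = edge_flux u w (x i, y j) (x i, y (Suc j))" for i j
  have "(?F has_integral (\<Sum>i=1..<n. \<Sum>j=1..<n. H i (Suc j) - H i j - (V (Suc i) j - V i j)))
      (cbox (0, 0) (L, L))"
  proof (rule has_integral_grid[OF x y])
    fix i j assume ij: "i \<in> {1..<n}" "j \<in> {1..<n}"
    have "split_cell (x i) (x (Suc i)) (y j) (y (Suc j)) (\<delta> i j) \<subseteq> \<T>"
      using ij unfolding \<T> by blast
    then show "(?F has_integral H i (Suc j) - H i j - (V (Suc i) j - V i j))
        (cbox (x i, y j) (x (Suc i), y (Suc j)))"
      unfolding H_def V_def using uN wN ij unfolding X_N_def
      by (intro has_integral_trilinear_cell[where \<delta> = "\<delta> i j"] cell_nondegenerate) blast+
  qed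
  moreover have "(\<Sum>i=1..<n. \<Sum>j=1..<n. H i (Suc j) - H i j - (V (Suc i) j - V i j)) = 0"
  proof -
    have n: "1 \<le> n" "x 1 = 0" "y 1 = 0" "x n = L" "y n = L"
      using x y by (auto simp: grid_def)
    note n' = n[unfolded One_nat_def]
    note n' = n[unfolded One_nat_def]
    have per: "u (s, L) = u (s, 0)" "w (s, L) = w (s, 0)" "u (L, s) = u (0, s)" "w (L, s) = w (0, s)"
      if "s \<in> {0..L}" for s
      using u w that by (auto simp: X_NP_def)
    have "(\<Sum>j=1..<n. H i (Suc j) - H i j) = 0" if "i \<in> {1..<n}" for i
      using that grid_mono(2)[OF x, of i] grid_mono(2)[OF x, of "Suc i"]
      by (intro sum_Suc_diff_periodic) (simp_all add: n' H_def edge_flux_def per)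
    then have "(\<Sum>i=1..<n. \<Sum>j=1..<n. H i (Suc j) - H i j) = 0"
      by simp
    moreover have "(\<Sum>i=1..<n. V (Suc i) j - V i j) = 0" if "j \<in> {1..<n}" for j
      using that grid_mono(2)[OF y, of j] grid_mono(2)[OF y, of "Suc j"]
      by (intro sum_Suc_diff_periodic) (simp_all add: n' V_def edge_flux_def per)
    then have "(\<Sum>j=1..<n. \<Sum>i=1..<n. V (Suc i) j - V i j) = 0"
      by simp
    then have "(\<Sum>i=1..<n. \<Sum>j=1..<n. V (Suc i) j - V i j) = 0"
      by (subst sum.swap)
    ultimately show ?thesis
      by (simp add: sum_subtractf)
  qed
  ultimately have F0: "integral (square L) ?F = 0"
    unfolding square_eq_box integral_open_interval by (simp add: integral_unique)
  \<comment> \<open>Essential boundedness makes the integrand Lebesgue integrable, so the gauge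
    integral computed above is the one in \<open>L2_inner\<close>.\<close>
  have "(\<lambda>z. fst (grad f z)) \<in> Linf (square L)" "(\<lambda>z. snd (grad f z)) \<in> Linf (square L)"
    if "f \<in> X_N L \<T>" for f
    using Linf_grad[OF that, of "(1, 0)"] Linf_grad[OF that, of "(0, 1)"] by (simp_all add: inner_prod_def)
  then have "(\<lambda>z. (- snd (grad u z) * fst (grad w z) + fst (grad u z) * snd (grad w z)) * w z) \<in> Linf (square L)"
    using uN wN Linf_X_N by (intro Linf_mult Linf_add Linf_uminus)
  then have "?F \<in> Linf (square L)"
    by (simp add: vec_V_def inner_prod_def)
  then have "integrable (lebesgue_on (square L)) ?F"
    using square_lmeasurable by (rule Linf_integrable)
  with F0 show ?thesis
    using square_lmeasurable[of L] by (simp add: L2_inner_def lebesgue_integral_eq_integral)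
qed

section \<open>One time step and the induction over time levels\<close>

text \<open>The equations are already tested, the elliptic one with \<open>u'\<close> and the
  evolution with \<open>w'\<close>. The transport term vanishes, and half of the squared norm of
  \<open>w'\<close> is lost to Young's inequality for \<open>w\<close> and \<open>w'\<close>;
  doubling turns the factor 3/4 into 3/2.\<close>

lemma implicit_step_bound:
  assumes p: "p \<in> W1inf (square L)" and \<tau>: "0 < \<tau>" "\<tau> * W1inf_norm (square L) p \<le> 1/6"
    and X: "u' \<in> X_NP L \<T>" "w \<in> X_NP L \<T>" "w' \<in> X_NP L \<T>"
    and ell: "H1_inner (square L) u' u' = L2_inner (square L) w' u'"
    and step: "L2_inner (square L) (\<lambda>z. w' z - w z) w' =
        \<tau> * L2_inner (square L) (\<lambda>z. vec_V (grad u') z \<bullet> grad w' z) w' +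
        \<tau> * L2_inner (square L) (\<lambda>z. vec_V (weak_grad (square L) p) z \<bullet> grad u' z) w'"
  shows "L2_inner (square L) w' w'
    \<le> exp (6 * (\<tau> * W1inf_norm (square L) p)) * L2_inner (square L) w w"
proof (rule implicit_step_growth)
  let ?S = "square L" and ?P = "W1inf_norm (square L) p"
  have P: "0 \<le> ?P" using p by (rule W1inf_norm_nonneg)
  then show "0 \<le> \<tau> * ?P" using \<tau> by simp
  show "0 \<le> L2_inner ?S w' w'" by (rule L2_inner_self_nonneg)
  have XN: "u' \<in> X_N L \<T>" "w \<in> X_N L \<T>" "w' \<in> X_N L \<T>"
    using X by (auto simp: X_NP_def)
  then have L2: "u' \<in> L2 ?S" "w \<in> L2 ?S" "w' \<in> L2 ?S"
    using Linf_X_N Linf_subset_L2 square_lmeasurable by blast+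
  have "L2_inner ?S (\<lambda>z. vec_V (weak_grad ?S p) z \<bullet> grad u' z) w'
      \<le> ?P * (L2_inner ?S (grad u') (grad u') + L2_inner ?S w' w' / 2)"
    using p XN by (intro L2_inner_convection_le square_lmeasurable Linf_X_N Linf_grad)
  \<comment> \<open>A quarter from the elliptic gradient bound plus the half already
    present.\<close>
  also have "\<dots> \<le> ?P * (3 / 4 * L2_inner ?S w' w')"
    using H1_inner_elliptic_bounds(2)[OF L2(1,3) ell] P by (intro mult_left_mono) auto
  finally have "\<tau> * L2_inner ?S (\<lambda>z. vec_V (weak_grad ?S p) z \<bullet> grad u' z) w'
      \<le> \<tau> * (?P * (3 / 4 * L2_inner ?S w' w'))"
    using \<tau> by (intro mult_left_mono) auto
  moreover have "L2_inner ?S (\<lambda>z. w' z - w z) w' = L2_inner ?S w' w' - L2_inner ?S w w'"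
    using L2 by (intro L2_inner_diff_left)
  moreover have "2 * L2_inner ?S w w' \<le> L2_inner ?S w w + L2_inner ?S w' w'"
    using L2_inner_young[OF L2(2,3), of 1] by simp
  ultimately show "L2_inner ?S w' w' * (1 - 3 / 2 * (\<tau> * ?P)) \<le> L2_inner ?S w w"
    using step trilinear_eq_0[OF X(1,3)] by (simp add: algebra_simps)
qed (fact \<tau>)

lemma fully_implicit_solution_w_bound:
  assumes p: "p \<in> W1inf (square L)" and \<tau>: "0 < \<tau>" "\<tau> * W1inf_norm (square L) p \<le> 1/6"
    and sol: "fully_implicit_solution L \<T> p T \<tau> w0 uN wN"
    and "real m * \<tau> \<le> T"
  shows "L2_inner (square L) (wN m) (wN m)
    \<le> exp (6 * (real m * \<tau> * W1inf_norm (square L) p)) * L2_inner (square L) (wN 0) (wN 0)"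
  using assms(5)
proof (induction m)
  case (Suc m)
  let ?S = "square L" and ?P = "W1inf_norm (square L) p"
  have m: "real m * \<tau> + \<tau> \<le> T" "real m * \<tau> \<le> T"
    using Suc.prems \<tau>(1) by (auto simp: algebra_simps)
  have X: "uN (Suc m) \<in> X_NP L \<T>" "wN m \<in> X_NP L \<T>" "wN (Suc m) \<in> X_NP L \<T>"
    using sol m Suc.prems unfolding fully_implicit_solution_def by blast+
  have eqs: "H1_inner ?S (uN (Suc m)) v = L2_inner ?S (wN (Suc m)) v"
    "L2_inner ?S (\<lambda>z. wN (Suc m) z - wN m z) v =
        \<tau> * L2_inner ?S (\<lambda>z. vec_V (grad (uN (Suc m))) z \<bullet> grad v z) (wN (Suc m)) +
        \<tau> * L2_inner ?S (\<lambda>z. vec_V (weak_grad ?S p) z \<bullet> grad (uN (Suc m)) z) v"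
    if "v \<in> X_NP L \<T>" for v
    using sol m that unfolding fully_implicit_solution_def by blast+
  have "L2_inner ?S (wN (Suc m)) (wN (Suc m)) \<le> exp (6 * (\<tau> * ?P)) * L2_inner ?S (wN m) (wN m)"
    using p \<tau> X eqs(1)[OF X(1)] eqs(2)[OF X(3)] by (rule implicit_step_bound)
  also have "\<dots> \<le> exp (6 * (\<tau> * ?P)) * (exp (6 * (real m * \<tau> * ?P)) * L2_inner ?S (wN 0) (wN 0))"
    using Suc.IH m by (intro mult_left_mono) auto
  also have "\<dots> = exp (6 * (real (Suc m) * \<tau> * ?P)) * L2_inner ?S (wN 0) (wN 0)"
    by (simp add: exp_add[symmetric] algebra_simps)
  finally show ?case .
qed simp

end

theorem theorem2p1:
  fixes L T \<tau> :: real and n :: nat and x y :: "nat \<Rightarrow> real"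
    and \<T> :: "(real \<times> real) set set"
    and p u0 w0 :: "real \<times> real \<Rightarrow> real"
    and uN wN :: "nat \<Rightarrow> real \<times> real \<Rightarrow> real"
  assumes "0 < L" and "0 < T"
    and "p \<in> W1inf (square L)"
    and "u0 \<in> H2 (square L) \<inter> H1_periodic L"
    and "w0 \<in> L2 (square L)"
    and "AE z in lebesgue_on (square L). w0 z = u0 z - weak_laplacian (square L) u0 z"
    and "grid L n x" and "grid L n y"
    and "structured_triangulation n x y \<T>"
    and "0 < \<tau>"
    and "ereal \<tau> < 1 / ereal (6 * W1inf_norm (square L) p)"
    and "fully_implicit_solution L \<T> p T \<tau> w0 uN wN"
  shows "\<forall>m. real m * \<tau> \<le> T \<longrightarrow>
    L2_norm (square L) (uN m)
      \<le> exp (3 * T * W1inf_norm (square L) p) * L2_norm (square L) (wN 0) \<and>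
    exp (3 * T * W1inf_norm (square L) p) * L2_norm (square L) (wN 0)
      \<le> exp (3 * T * W1inf_norm (square L) p) * L2_norm (square L) w0 \<and>
    L2_norm (square L) (wN m)
      \<le> exp (3 * T * W1inf_norm (square L) p) * L2_norm (square L) (wN 0)"
proof (intro allI impI)
  fix m assume m: "real m * \<tau> \<le> T"
  let ?S = "square L" and ?P = "W1inf_norm (square L) p"
  interpret triangulated_square L n x y \<T>
    using assms by unfold_locales
  have P: "0 \<le> ?P" using assms(3) by (rule W1inf_norm_nonneg)
  have \<tau>P: "\<tau> * ?P \<le> 1/6"
  proof (cases "?P = 0")
    case False
    \<comment> \<open>Away from zero the extended quotient is an ordinary real one; for
      \<open>?P = 0\<close> the claim is immediate.\<close>
    then have "1 / ereal (6 * ?P) = ereal (1 / (6 * ?P))"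
      by (simp add: one_ereal_def)
    with assms(11) False P show ?thesis
      by (simp add: field_simps)
  qed simp
  have X_NP_L2: "X_NP L \<T> \<subseteq> L2 ?S"
    using Linf_X_N Linf_subset_L2 square_lmeasurable by (auto simp: X_NP_def)
  have X: "uN m \<in> X_NP L \<T>" "wN m \<in> X_NP L \<T>"
    using assms(12) m unfolding fully_implicit_solution_def by blast+
  have "L2_inner ?S (wN m) (wN m) \<le> exp (6 * (real m * \<tau> * ?P)) * L2_inner ?S (wN 0) (wN 0)"
    using assms(3,10) \<tau>P assms(12) m by (rule fully_implicit_solution_w_bound)
  \<comment> \<open>Uses \<open>m * \<tau> \<le> T\<close>. The exponent is written as a double so
    that the square root yields \<open>exp (3 * T * ?P)\<close>.\<close>
  also have "\<dots> \<le> exp (2 * (3 * T * ?P)) * L2_inner ?S (wN 0) (wN 0)"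
    using m P mult_right_mono[OF m P] by (intro mult_right_mono L2_inner_self_nonneg) auto
  finally have "L2_norm ?S (wN m) \<le> sqrt ((exp (3 * T * ?P))\<^sup>2 * L2_inner ?S (wN 0) (wN 0))"
    by (simp only: L2_norm_def exp_double real_sqrt_le_iff)
  then have w: "L2_norm ?S (wN m) \<le> exp (3 * T * ?P) * L2_norm ?S (wN 0)"
    by (simp add: L2_norm_def real_sqrt_mult)
  have "H1_inner ?S (uN m) (uN m) = L2_inner ?S (wN m) (uN m)"
  \<comment> \<open>At time 0 the elliptic equation is part of the initial condition; later it comes
    from the step that ends at \<open>Suc k\<close>.\<close>
  proof (cases m)
    case 0
    then show ?thesis using assms(12) X unfolding fully_implicit_solution_def by blast
  next
    case (Suc k)
    then have "real k * \<tau> + \<tau> \<le> T" using m by (simp add: algebra_simps)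
    then show ?thesis using Suc assms(12) X unfolding fully_implicit_solution_def by blast
  qed
  with X X_NP_L2 have "L2_norm ?S (uN m) \<le> L2_norm ?S (wN m)"
    by (auto simp: L2_norm_le_iff intro: H1_inner_elliptic_bounds(1))
  with w have u: "L2_norm ?S (uN m) \<le> exp (3 * T * ?P) * L2_norm ?S (wN 0)"
    by (rule order_trans[rotated])
  have "is_L2_projection ?S (X_NP L \<T>) w0 (wN 0)"
    using assms(12) by (simp add: fully_implicit_solution_def)
  then have "L2_norm ?S (wN 0) \<le> L2_norm ?S w0"
    using assms(5) X_NP_L2 by (rule L2_projection_norm_le)
  with u w show "L2_norm ?S (uN m) \<le> exp (3 * T * ?P) * L2_norm ?S (wN 0) \<and>
      exp (3 * T * ?P) * L2_norm ?S (wN 0) \<le> exp (3 * T * ?P) * L2_norm ?S w0 \<and>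
      L2_norm ?S (wN m) \<le> exp (3 * T * ?P) * L2_norm ?S (wN 0)"
    by simp
qed

end
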